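(* Let $G$ be a graph and let $\ell$ be a weakly subadditive nonnegative integer-valued function on subsets of $V(G)$ with $\ell(\emptyset)=\ell(V(G))=0$. Then $G$ is minimally $\ell$-rigid if and only if $G$ has an $\ell$-arc-connected orientation such that $d^-_G(v)=\ell(v)$ for each vertex $v$.
   Context: Graphs are finite, loopless, multiple edges allowed. $e_G(X)$ is the number of edges with both ends in $X$; $\ell(v)=\ell(\{v\})$; weakly subadditive means $\sum_{v\in A}\ell(v)\ge\ell(A)$ for all $A$. $G$ is minimally $\ell$-rigid if $e_G(X)\le\sum_{v\in X}\ell(v)-\ell(X)$ for all $X\subseteq V(G)$ and $|E(G)|=\sum_{v\in V(G)}\ell(v)-\ell(V(G))$ (equivalently, $G$ is $\ell$-rigid but no proper spanning subgraph is). In an orientation, $d^-(v)$ is the number of arcs entering $v$ and $d^-(A)$ is the number of arcs entering $A$ (tail outside $A$, head in $A$); the orientation is $\ell$-arc-connected if $d^-(A)\ge\ell(A)$ for every vertex set $A$. *)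

theory Defs
  imports "Graph_Theory.Digraph"
begin

(* Undirected multigraphs: edges are abstract objects, so parallel edges are distinct
   elements of the edge set with the same two-element set of ends. *)
record ('v, 'e) multigraph =
  vertices :: "'v set"
  edges :: "'e set"
  ends :: "'e \<Rightarrow> 'v set"

locale finite_multigraph =
  fixes G :: "('v, 'e) multigraph"
  assumes finite_vertices: "finite (vertices G)"
    and finite_edges: "finite (edges G)"
    and ends_subset: "e \<in> edges G \<Longrightarrow> ends G e \<subseteq> vertices G"
    and card_ends: "e \<in> edges G \<Longrightarrow> card (ends G e) = 2"

definition induced_edge_count :: "('v, 'e) multigraph \<Rightarrow> 'v set \<Rightarrow> nat" where
  "induced_edge_count G X = card {e \<in> edges G. ends G e \<subseteq> X}"

definition weakly_subadditive_on :: "'v set \<Rightarrow> ('v set \<Rightarrow> int) \<Rightarrow> bool" where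
  "weakly_subadditive_on V l \<longleftrightarrow> (\<forall>A\<subseteq>V. l A \<le> (\<Sum>v\<in>A. l {v}))"

definition minimally_rigid :: "('v set \<Rightarrow> int) \<Rightarrow> ('v, 'e) multigraph \<Rightarrow> bool" where
  "minimally_rigid l G \<longleftrightarrow>
     (\<forall>X\<subseteq>vertices G. int (induced_edge_count G X) \<le> (\<Sum>v\<in>X. l {v}) - l X) \<and>
     int (card (edges G)) = (\<Sum>v\<in>vertices G. l {v}) - l (vertices G)"

definition orientation_of :: "('v, 'e) pre_digraph \<Rightarrow> ('v, 'e) multigraph \<Rightarrow> bool" where
  "orientation_of D G \<longleftrightarrow>
     verts D = vertices G \<and> arcs D = edges G \<and>
     (\<forall>e\<in>edges G. {tail D e, head D e} = ends G e)"

definition set_in_degree :: "('v, 'e) pre_digraph \<Rightarrow> 'v set \<Rightarrow> nat" where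
  "set_in_degree D A = card {e \<in> arcs D. tail D e \<notin> A \<and> head D e \<in> A}"

definition arc_connected :: "('v set \<Rightarrow> int) \<Rightarrow> ('v, 'e) pre_digraph \<Rightarrow> bool" where
  "arc_connected l D \<longleftrightarrow> (\<forall>A\<subseteq>verts D. l A \<le> int (set_in_degree D A))"

end

theory Submission
  imports Defs
begin

text \<open>
  The arcs of an orientation with head in \<open>A\<close> either enter \<open>A\<close> or lie inside \<open>A\<close>, so the
  in-degrees of the vertices of \<open>A\<close> add up to the in-degree of \<open>A\<close> plus the number of edges induced
  by \<open>A\<close>. Once the in-degrees are prescribed by \<open>l\<close>, arc-connectivity is therefore the same as the
  sparsity condition. What remains is Hakimi's theorem: heads can be chosen such that every vertex
  \<open>v\<close> is chosen at most \<open>m v\<close> times if every \<open>X\<close> induces at most \<open>m(X)\<close> edges. Call \<open>X\<close> tight if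
  it induces exactly \<open>m(X)\<close> edges. If an edge \<open>e\<close> cannot be given the head \<open>w\<close>, then \<open>w\<close> lies in a
  set that is tight without \<open>e\<close>. By supermodularity of the induced edge count, tight sets are closed
  under union, so if all ends of \<open>e\<close> were excluded, some tight set would contain all of them, and
  restoring \<open>e\<close> would violate the hypothesis.
\<close>

definition delete_edge :: "'e \<Rightarrow> ('v, 'e) multigraph \<Rightarrow> ('v, 'e) multigraph" where
  "delete_edge e G = G\<lparr>edges := edges G - {e}\<rparr>"

lemma delete_edge_simps [simp]:
  "vertices (delete_edge e G) = vertices G"
  "edges (delete_edge e G) = edges G - {e}"
  "ends (delete_edge e G) = ends G"
  by (simp_all add: delete_edge_def)

lemma induced_edge_count_delete_edge:
  assumes "finite (edges G)" "e \<in> edges G"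
  shows "induced_edge_count G X =
    induced_edge_count (delete_edge e G) X + (if ends G e \<subseteq> X then 1 else 0)"
proof (cases "ends G e \<subseteq> X")
  case True
  then have "{f \<in> edges G. ends G f \<subseteq> X} =
      insert e {f \<in> edges (delete_edge e G). ends G f \<subseteq> X}"
    using assms(2) by auto
  then show ?thesis
    using True assms(1) by (simp add: induced_edge_count_def)
next
  case False
  then have "{f \<in> edges G. ends G f \<subseteq> X} = {f \<in> edges (delete_edge e G). ends G f \<subseteq> X}"
    by auto
  then show ?thesis
    using False by (simp add: induced_edge_count_def)
qed

lemma induced_edge_count_supermodular:
  assumes "finite (edges G)"
  shows "induced_edge_count G X + induced_edge_count G Y \<le>
    induced_edge_count G (X \<union> Y) + induced_edge_count G (X \<inter> Y)"
proof -
  let ?I = "\<lambda>X. {e \<in> edges G. ends G e \<subseteq> X}"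
  have "card (?I X) + card (?I Y) = card (?I X \<union> ?I Y) + card (?I X \<inter> ?I Y)"
    using assms by (intro card_Un_Int) auto
  moreover have "card (?I X \<union> ?I Y) \<le> card (?I (X \<union> Y))"
    using assms by (intro card_mono) auto
  moreover have "?I X \<inter> ?I Y = ?I (X \<inter> Y)"
    by auto
  ultimately show ?thesis
    by (simp add: induced_edge_count_def)
qed

definition sparse :: "('v \<Rightarrow> int) \<Rightarrow> ('v, 'e) multigraph \<Rightarrow> bool" where
  "sparse m G \<longleftrightarrow> (\<forall>X\<subseteq>vertices G. int (induced_edge_count G X) \<le> sum m X)"

definition tight :: "('v \<Rightarrow> int) \<Rightarrow> ('v, 'e) multigraph \<Rightarrow> 'v set \<Rightarrow> bool" where
  "tight m G X \<longleftrightarrow> X \<subseteq> vertices G \<and> int (induced_edge_count G X) = sum m X"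

lemma sparseD:
  "sparse m G \<Longrightarrow> X \<subseteq> vertices G \<Longrightarrow> int (induced_edge_count G X) \<le> sum m X"
  by (simp add: sparse_def)

lemma sparse_delete_edge:
  assumes "sparse m G" "finite (edges G)" "e \<in> edges G"
  shows "sparse m (delete_edge e G)"
  unfolding sparse_def delete_edge_simps
proof (intro allI impI)
  fix X
  assume "X \<subseteq> vertices G"
  then have "int (induced_edge_count G X) \<le> sum m X"
    by (rule sparseD[OF assms(1)])
  then show "int (induced_edge_count (delete_edge e G) X) \<le> sum m X"
    using induced_edge_count_delete_edge[OF assms(2,3), of X] by linarith
qed

lemma tight_empty:
  assumes "sparse m G"
  shows "tight m G {}"
  using sparseD[OF assms, of "{}"] by (simp add: tight_def)

lemma tight_Un:
  assumes "finite (vertices G)" "finite (edges G)" "sparse m G" "tight m G X" "tight m G Y"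
  shows "tight m G (X \<union> Y)"
proof -
  have subsets: "X \<subseteq> vertices G" "Y \<subseteq> vertices G"
    using assms(4,5) by (auto simp: tight_def)
  then have "finite X" "finite Y"
    using assms(1) finite_subset by auto
  then have "sum m (X \<union> Y) + sum m (X \<inter> Y) = sum m X + sum m Y"
    by (rule sum.union_inter)
  also have "\<dots> = int (induced_edge_count G X + induced_edge_count G Y)"
    using assms(4,5) by (simp add: tight_def)
  also have "\<dots> \<le> int (induced_edge_count G (X \<union> Y) + induced_edge_count G (X \<inter> Y))"
    using induced_edge_count_supermodular[OF assms(2)] by (simp only: of_nat_le_iff)
  finally have "sum m (X \<union> Y) + sum m (X \<inter> Y) \<le>
      int (induced_edge_count G (X \<union> Y)) + int (induced_edge_count G (X \<inter> Y))"
    by simp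
  moreover have "int (induced_edge_count G (X \<inter> Y)) \<le> sum m (X \<inter> Y)"
    using subsets by (intro sparseD[OF assms(3)]) auto
  moreover have "int (induced_edge_count G (X \<union> Y)) \<le> sum m (X \<union> Y)"
    using subsets by (intro sparseD[OF assms(3)]) auto
  ultimately show ?thesis
    using subsets by (simp add: tight_def)
qed

lemma tight_Union:
  assumes "finite (vertices G)" "finite (edges G)" "sparse m G"
    and "\<And>X. X \<in> \<X> \<Longrightarrow> tight m G X"
  shows "tight m G (\<Union>\<X>)"
proof -
  have "\<X> \<subseteq> Pow (vertices G)"
    using assms(4) by (auto simp: tight_def)
  then have "finite \<X>"
    using assms(1) finite_subset by blast
  then show ?thesis
    using assms(4)
  proof (induction \<X> rule: finite_induct)
    case empty
    then show ?case using tight_empty[OF assms(3)] by simp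
  next
    case (insert X \<X>)
    then show ?case using tight_Un[OF assms(1-3)] by simp
  qed
qed

lemma ex_tight_if_not_sparse_decrement:
  assumes "finite (vertices G)" "sparse m G" "\<not> sparse (m(w := m w - 1)) G"
  shows "\<exists>X. tight m G X \<and> w \<in> X"
proof -
  obtain X where X: "X \<subseteq> vertices G"
    and excess: "sum (m(w := m w - 1)) X < int (induced_edge_count G X)"
    using assms(3) by (auto simp: sparse_def not_le)
  have bound: "int (induced_edge_count G X) \<le> sum m X"
    using assms(2) X by (rule sparseD)
  have w_in: "w \<in> X"
  proof (rule ccontr)
    assume "w \<notin> X"
    then have "sum (m(w := m w - 1)) X = sum m X"
      by (auto intro: sum.cong)
    with excess bound show False by simp
  qed
  have "finite X"
    using X assms(1) finite_subset by blast
  then have "sum (m(w := m w - 1)) X = sum m X - 1"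
    using w_in by (simp add: sum.remove[of X w])
  with excess bound have "tight m G X"
    using X by (simp add: tight_def)
  with w_in show ?thesis by blast
qed

lemma ex_end_sparse_delete_edge:
  assumes "finite (vertices G)" "finite (edges G)" "sparse m G" "e \<in> edges G"
  shows "\<exists>w\<in>ends G e. sparse (m(w := m w - 1)) (delete_edge e G)"
proof (rule ccontr)
  assume not_sparse: "\<not> ?thesis"
  let ?G = "delete_edge e G"
  let ?T = "\<Union>{X. tight m ?G X}"
  have sparse: "sparse m ?G"
    using assms(2-4) by (intro sparse_delete_edge)
  have "\<exists>X. tight m ?G X \<and> w \<in> X" if "w \<in> ends G e" for w
    using assms(1) sparse not_sparse that by (intro ex_tight_if_not_sparse_decrement) auto
  then have "ends G e \<subseteq> ?T"
    by blast
  then have "induced_edge_count G ?T = induced_edge_count ?G ?T + 1"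
    using induced_edge_count_delete_edge[OF assms(2,4)] by simp
  moreover have "tight m ?G ?T"
    using assms(1,2) sparse by (intro tight_Union) auto
  then have "?T \<subseteq> vertices G" "int (induced_edge_count ?G ?T) = sum m ?T"
    by (auto simp only: tight_def delete_edge_simps)
  ultimately show False
    using sparseD[OF assms(3), of ?T] by linarith
qed

lemma card_fibre_fun_upd:
  assumes "finite E" "e \<in> E"
  shows "card {f \<in> E. (h(e := w)) f = v} =
    card {f \<in> E - {e}. h f = v} + (if v = w then 1 else 0)"
proof (cases "v = w")
  case True
  then have "{f \<in> E. (h(e := w)) f = v} = insert e {f \<in> E - {e}. h f = v}"
    using assms(2) by auto
  then show ?thesis using True assms(1) by simp
next
  case False
  then have "{f \<in> E. (h(e := w)) f = v} = {f \<in> E - {e}. h f = v}"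
    by auto
  then show ?thesis using False by simp
qed

text \<open>Edges may have any number of ends here, so this is Hall's theorem with capacities.\<close>

theorem ex_heads_card_fibre_le:
  assumes "finite (vertices G)" "finite (edges G)" "sparse m G"
  shows "\<exists>h. (\<forall>e\<in>edges G. h e \<in> ends G e) \<and>
    (\<forall>v\<in>vertices G. int (card {e \<in> edges G. h e = v}) \<le> m v)"
  using assms(2,1,3)
proof (induction "edges G" arbitrary: G m rule: finite_induct)
  case empty
  have "0 \<le> m v" if "v \<in> vertices G" for v
    using sparseD[OF empty.prems(2), of "{v}"] that by simp
  then show ?case by (simp flip: empty.hyps)
next
  case (insert e E)
  have e: "e \<in> edges G" and E: "E = edges (delete_edge e G)" and finite_edges: "finite (edges G)"
    using insert.hyps by (auto simp flip: insert.hyps(4))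
  obtain w where w: "w \<in> ends G e"
    and sparse: "sparse (m(w := m w - 1)) (delete_edge e G)"
    using ex_end_sparse_delete_edge[OF insert.prems(1) finite_edges insert.prems(2) e] by blast
  obtain h where h: "\<forall>f\<in>edges G - {e}. h f \<in> ends G f"
    and fibres: "\<forall>v\<in>vertices G. int (card {f \<in> edges G - {e}. h f = v}) \<le> (m(w := m w - 1)) v"
    using insert.hyps(3)[OF E _ sparse] insert.prems(1) unfolding delete_edge_simps by blast
  have "(h(e := w)) f \<in> ends G f" if "f \<in> edges G" for f
    using h w that by simp
  moreover have "int (card {f \<in> edges G. (h(e := w)) f = v}) \<le> m v" if "v \<in> vertices G" for v
    unfolding card_fibre_fun_upd[OF finite_edges e] using bspec[OF fibres that] by (auto split: if_splits)
  ultimately show ?case by blast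
qed

lemma sum_in_degree:
  assumes "finite (arcs D)" "finite A"
  shows "(\<Sum>v\<in>A. in_degree D v) =
    set_in_degree D A + card {e \<in> arcs D. tail D e \<in> A \<and> head D e \<in> A}"
proof -
  have "(\<Sum>v\<in>A. in_degree D v) = card (\<Union>v\<in>A. in_arcs D v)"
    unfolding in_degree_def using assms
    by (intro card_UN_disjoint[symmetric]) (auto simp: in_arcs_def)
  also have "(\<Union>v\<in>A. in_arcs D v) = {e \<in> arcs D. tail D e \<notin> A \<and> head D e \<in> A} \<union>
      {e \<in> arcs D. tail D e \<in> A \<and> head D e \<in> A}"
    by (auto simp: in_arcs_def)
  also have "card \<dots> = set_in_degree D A + card {e \<in> arcs D. tail D e \<in> A \<and> head D e \<in> A}"
    unfolding set_in_degree_def using assms(1) by (intro card_Un_disjoint) auto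
  finally show ?thesis .
qed

lemma induced_edge_count_orientation:
  assumes "orientation_of D G"
  shows "induced_edge_count G A = card {e \<in> arcs D. tail D e \<in> A \<and> head D e \<in> A}"
proof -
  have "arcs D = edges G" and "\<And>e. e \<in> edges G \<Longrightarrow> ends G e = {tail D e, head D e}"
    using assms by (auto simp: orientation_of_def)
  then have "{e \<in> edges G. ends G e \<subseteq> A} = {e \<in> arcs D. tail D e \<in> A \<and> head D e \<in> A}"
    by auto
  then show ?thesis
    by (simp add: induced_edge_count_def)
qed

context finite_multigraph
begin

lemma sum_in_degree_orientation:
  assumes "orientation_of D G" "A \<subseteq> vertices G"
  shows "(\<Sum>v\<in>A. in_degree D v) = set_in_degree D A + induced_edge_count G A"
proof -
  have "finite (arcs D)"
    using assms(1) finite_edges by (simp add: orientation_of_def)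
  moreover have "finite A"
    using assms(2) finite_vertices by (rule finite_subset)
  ultimately show ?thesis
    using assms(1) by (simp add: sum_in_degree induced_edge_count_orientation)
qed

lemma sum_in_degree_vertices:
  assumes "orientation_of D G"
  shows "(\<Sum>v\<in>vertices G. in_degree D v) = card (edges G)"
proof -
  have "{e \<in> arcs D. tail D e \<notin> vertices G \<and> head D e \<in> vertices G} = {}"
    using assms ends_subset unfolding orientation_of_def by blast
  then have "set_in_degree D (vertices G) = 0"
    by (simp only: set_in_degree_def card.empty)
  moreover have "{e \<in> edges G. ends G e \<subseteq> vertices G} = edges G"
    using ends_subset by blast
  then have "induced_edge_count G (vertices G) = card (edges G)"
    by (simp only: induced_edge_count_def)
  ultimately show ?thesis
    using sum_in_degree_orientation[OF assms subset_refl] by simp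
qed

lemma ex_orientation_with_heads:
  assumes "\<And>e. e \<in> edges G \<Longrightarrow> h e \<in> ends G e"
  shows "\<exists>D. orientation_of D G \<and> head D = h"
proof -
  have "\<exists>u. {u, h e} = ends G e" if e: "e \<in> edges G" for e
  proof -
    obtain u v where "ends G e = {u, v}"
      using card_ends[OF e] by (auto simp: card_2_iff)
    then show ?thesis using assms[OF e] by auto
  qed
  then obtain t where "\<And>e. e \<in> edges G \<Longrightarrow> {t e, h e} = ends G e" by metis
  then have "orientation_of \<lparr>verts = vertices G, arcs = edges G, tail = t, head = h\<rparr> G"
    by (simp add: orientation_of_def)
  then show ?thesis by (intro exI conjI) auto
qed

theorem ex_orientation_in_degree_le:
  assumes "sparse m G"
  shows "\<exists>D. orientation_of D G \<and> (\<forall>v\<in>vertices G. int (in_degree D v) \<le> m v)"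
proof -
  obtain h where h: "\<And>e. e \<in> edges G \<Longrightarrow> h e \<in> ends G e"
    and fibres: "\<forall>v\<in>vertices G. int (card {e \<in> edges G. h e = v}) \<le> m v"
    using ex_heads_card_fibre_le[OF finite_vertices finite_edges assms] by blast
  obtain D where "orientation_of D G" "head D = h"
    using ex_orientation_with_heads[OF h] by blast
  with fibres show ?thesis
    by (auto simp: in_degree_def in_arcs_def orientation_of_def)
qed

corollary ex_orientation_in_degree_eq:
  assumes "sparse m G" "int (card (edges G)) = sum m (vertices G)"
  shows "\<exists>D. orientation_of D G \<and> (\<forall>v\<in>vertices G. int (in_degree D v) = m v)"
proof -
  obtain D where D: "orientation_of D G"
    and in_degree_le: "\<And>v. v \<in> vertices G \<Longrightarrow> int (in_degree D v) \<le> m v"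
    using ex_orientation_in_degree_le[OF assms(1)] by blast
  have "(\<Sum>v\<in>vertices G. int (in_degree D v)) = sum m (vertices G)"
    using sum_in_degree_vertices[OF D] assms(2) by (simp flip: of_nat_sum)
  then have "int (in_degree D v) = m v" if "v \<in> vertices G" for v
    using in_degree_le that finite_vertices
    by (rule sum_mono_inv[where f = "\<lambda>v. int (in_degree D v)" and g = m])
  with D show ?thesis by blast
qed

lemma minimally_rigid_iff_arc_connected:
  assumes D: "orientation_of D G" "\<And>v. v \<in> vertices G \<Longrightarrow> int (in_degree D v) = l {v}"
    and l: "l (vertices G) = 0"
  shows "minimally_rigid l G \<longleftrightarrow> arc_connected l D"
proof -
  have degree_sum: "(\<Sum>v\<in>A. l {v}) = int (\<Sum>v\<in>A. in_degree D v)" if "A \<subseteq> vertices G" for A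
    unfolding of_nat_sum using D(2) that by (intro sum.cong) auto
  have "int (induced_edge_count G A) \<le> (\<Sum>v\<in>A. l {v}) - l A \<longleftrightarrow> l A \<le> int (set_in_degree D A)"
    if "A \<subseteq> vertices G" for A
    unfolding degree_sum[OF that] sum_in_degree_orientation[OF D(1) that] by auto
  moreover have "int (card (edges G)) = (\<Sum>v\<in>vertices G. l {v}) - l (vertices G)"
    unfolding degree_sum[OF subset_refl] sum_in_degree_vertices[OF D(1)] l by simp
  moreover have "verts D = vertices G"
    using D(1) by (simp add: orientation_of_def)
  ultimately show ?thesis
    by (simp add: minimally_rigid_def arc_connected_def)
qed

lemma minimally_rigid_imp_ex_orientation:
  assumes "minimally_rigid l G" "\<And>A. A \<subseteq> vertices G \<Longrightarrow> 0 \<le> l A" "l (vertices G) = 0"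
  shows "\<exists>D. orientation_of D G \<and> (\<forall>v\<in>vertices G. int (in_degree D v) = l {v})"
proof (rule ex_orientation_in_degree_eq)
  show "sparse (\<lambda>v. l {v}) G"
    unfolding sparse_def
  proof (intro allI impI)
    fix X
    assume X: "X \<subseteq> vertices G"
    then have "int (induced_edge_count G X) \<le> (\<Sum>v\<in>X. l {v}) - l X"
      using assms(1) by (simp add: minimally_rigid_def)
    with assms(2)[OF X] show "int (induced_edge_count G X) \<le> (\<Sum>v\<in>X. l {v})"
      by linarith
  qed
  show "int (card (edges G)) = (\<Sum>v\<in>vertices G. l {v})"
    using assms(1,3) by (simp add: minimally_rigid_def)
qed

end

theorem theorem7p2:
  fixes G :: "('v, 'e) multigraph" and l :: "'v set \<Rightarrow> int"
  assumes "finite_multigraph G"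
    and "\<And>A. A \<subseteq> vertices G \<Longrightarrow> 0 \<le> l A"
    and "weakly_subadditive_on (vertices G) l"
    and "l {} = 0" and "l (vertices G) = 0"
  shows "minimally_rigid l G \<longleftrightarrow>
    (\<exists>D. orientation_of D G \<and> arc_connected l D \<and>
         (\<forall>v\<in>vertices G. int (in_degree D v) = l {v}))"
proof -
  interpret finite_multigraph G by fact
  have equiv: "minimally_rigid l G \<longleftrightarrow> arc_connected l D"
    if "orientation_of D G" "\<forall>v\<in>vertices G. int (in_degree D v) = l {v}"
    for D :: "('v, 'e) pre_digraph"
    using that assms(5) by (intro minimally_rigid_iff_arc_connected) auto
  show ?thesis
  proof
    assume rigid: "minimally_rigid l G"
    then obtain D where "orientation_of D G" "\<forall>v\<in>vertices G. int (in_degree D v) = l {v}"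
      using minimally_rigid_imp_ex_orientation assms(2,5) by blast
    with rigid equiv show "\<exists>D. orientation_of D G \<and> arc_connected l D \<and>
        (\<forall>v\<in>vertices G. int (in_degree D v) = l {v})"
      by blast
  next
    assume "\<exists>D. orientation_of D G \<and> arc_connected l D \<and>
        (\<forall>v\<in>vertices G. int (in_degree D v) = l {v})"
    with equiv show "minimally_rigid l G" by blast
  qed
qed

end
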